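(* Let $d\ge1$ and consider weight systems supported on generators whose sign pattern is identically $\mathrm U$, so that each generator is identified with its active set $\emptyset\ne I\subseteq[d]$ and carries a weight $w^U_I$. Then for every nonempty $J\subseteq[d]$ the complete upper-tail coefficient satisfies $$\lambda^U_J=\sum_{I\supseteq J}w^U_I,$$ which is the zeta (incidence) system of the Boolean lattice restricted to nonempty subsets of $[d]$. Hence the complete-case backward recovery reduces to the Möbius inversion formula $$w^U_I=\sum_{K\supseteq I}(-1)^{|K|-|I|}\lambda^U_K,\qquad\emptyset\ne I\subseteq[d].$$
   Context: $[d]=\{1,\dots,d\}$; $\mathcal G_d=\{(I,\sigma):\emptyset\ne I\subseteq[d],\ \sigma\in\{\mathrm L,\mathrm U\}^I\}$, where $\{\mathrm L,\mathrm U\}^I$ is the set of functions $I\to\{\mathrm L,\mathrm U\}$. A weight system $w=(w_{I,\sigma})_{(I,\sigma)\in\mathcal G_d}$ induces the complete signed tail family $\lambda_{J,\tau}=\sum_{(I,\sigma)\in\mathcal G_d:\,I\supseteq J,\,\sigma|_J=\tau}w_{I,\sigma}$. For a weight system with $w_{I,\sigma}=0$ unless $\sigma\equiv\mathrm U$ on $I$, write $w^U_I=w_{I,(\mathrm U,\dots,\mathrm U)}$ and $\lambda^U_J=\lambda_{J,(\mathrm U,\dots,\mathrm U)}$. The complete-case backward recovery is the recursion, by descending $|I|$, $w_{I,\sigma}=\lambda_{I,\sigma}-\sum_{K\supsetneq I}\sum_{\rho:\rho|_I=\sigma}w_{K,\rho}$. *)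

theory Defs
  imports Complex_Main "HOL-Library.FuncSet"
begin

datatype side = Lower | Upper

text \<open>
  A sign pattern on \<open>I\<close> is an extensional function on \<open>I\<close>, so that distinct elements of
  \<open>I \<rightarrow>\<^sub>E UNIV\<close> are distinct functions \<open>I \<rightarrow> {L, U}\<close>, and \<open>restrict \<sigma> J\<close>
  is the restriction of \<open>\<sigma>\<close> to \<open>J\<close>.
\<close>

type_synonym pattern = "nat \<Rightarrow> side"

abbreviation sign_patterns :: "nat set \<Rightarrow> pattern set" where
  "sign_patterns I \<equiv> I \<rightarrow>\<^sub>E (UNIV :: side set)"

definition nonempty_subsets :: "nat \<Rightarrow> nat set set" where
  "nonempty_subsets d = {I. I \<noteq> {} \<and> I \<subseteq> {1..d}}"

definition generators :: "nat \<Rightarrow> (nat set \<times> pattern) set" where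
  "generators d = (SIGMA I : nonempty_subsets d. sign_patterns I)"

text \<open>
  Families indexed by \<open>generators d\<close> are functions on all pairs; only their values on
  \<open>generators d\<close> matter.
\<close>

definition signed_tail ::
  "nat \<Rightarrow> (nat set \<times> pattern \<Rightarrow> real) \<Rightarrow> nat set \<times> pattern \<Rightarrow> real" where
  "signed_tail d w = (\<lambda>(J, \<tau>).
     \<Sum>(I, \<sigma>) \<in> {(I, \<sigma>) \<in> generators d. J \<subseteq> I \<and> restrict \<sigma> J = \<tau>}. w (I, \<sigma>))"

definition all_upper :: "nat set \<Rightarrow> pattern" where
  "all_upper I = restrict (\<lambda>_. Upper) I"

definition upper_part :: "(nat set \<times> pattern \<Rightarrow> real) \<Rightarrow> nat set \<Rightarrow> real" where
  "upper_part f I = f (I, all_upper I)"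

definition upper_supported :: "nat \<Rightarrow> (nat set \<times> pattern \<Rightarrow> real) \<Rightarrow> bool" where
  "upper_supported d w \<longleftrightarrow>
     (\<forall>(I, \<sigma>) \<in> generators d. \<not> (\<forall>i\<in>I. \<sigma> i = Upper) \<longrightarrow> w (I, \<sigma>) = 0)"

function backward_recovery ::
  "nat \<Rightarrow> (nat set \<times> pattern \<Rightarrow> real) \<Rightarrow> nat set \<times> pattern \<Rightarrow> real" where
  "backward_recovery d \<Lambda> (I, \<sigma>) = \<Lambda> (I, \<sigma>) -
     (\<Sum>K \<in> {K. I \<subset> K \<and> K \<subseteq> {1..d}}.
        \<Sum>\<rho> \<in> {\<rho> \<in> sign_patterns K. restrict \<rho> I = \<sigma>}. backward_recovery d \<Lambda> (K, \<rho>))"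
  by pat_completeness auto
termination
proof (relation "measure (\<lambda>(d, \<Lambda>, I, \<sigma>). card ({1..d} - I))", goal_cases)
  case 1
  show ?case by simp
next
  case (2 d \<Lambda> I \<sigma> K \<rho>)
  then have "{1..d} - K \<subset> {1..d} - I" by auto
  then show ?case by (simp add: psubset_card_mono)
qed

text \<open>The defining equation rewrites forever when used unconditionally by the simplifier.\<close>

declare backward_recovery.simps [simp del]

definition zeta :: "'a::order \<Rightarrow> 'a \<Rightarrow> real" where
  "zeta x y = (if x \<le> y then 1 else 0)"

end

theory Submission
  imports Defs
begin

text \<open>
  Peeling off the term \<open>K = I\<close> of a signed tail isolates \<open>w (I, \<sigma>)\<close>, because the only
  pattern on \<open>I\<close> that restricts to \<open>\<sigma>\<close> is \<open>\<sigma>\<close> itself; the remaining terms live on strict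
  supersets of \<open>I\<close>. Hence the backward recovery inverts the tail transform for every weight
  system (\<open>backward_recovery_signed_tail\<close>), and its output on the tails of \<open>w\<close> is simply \<open>w\<close>.

  If \<open>w\<close> lives on the all-\<open>Upper\<close> patterns, then among the patterns on \<open>K\<close> that extend the
  all-\<open>Upper\<close> pattern on \<open>J\<close> only one carries weight, so the double sum defining the tail
  collapses to a sum over the supersets of \<open>J\<close> (\<open>upper_part_signed_tail\<close>). Such superset sums
  are undone by alternating sums, by \<open>superset_moebius_inversion\<close>. Both descriptions of
  \<open>w\<close> from its tails hold at once, so the recovery reduces to the Moebius formula.
\<close>

text \<open>
  Complementation in \<open>D\<close> reverses inclusion, so this is the order dual of the inversion
  formula for subset sums, \<open>inclusion_exclusion_mobius\<close>.
\<close>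

lemma superset_moebius_inversion:
  fixes v \<Lambda> :: "'a set \<Rightarrow> 'b::ring_1"
  assumes "finite D" and "I \<subseteq> D"
    and tail: "\<And>J. I \<subseteq> J \<Longrightarrow> J \<subseteq> D \<Longrightarrow> \<Lambda> J = (\<Sum>K | J \<subseteq> K \<and> K \<subseteq> D. v K)"
  shows "v I = (\<Sum>K | I \<subseteq> K \<and> K \<subseteq> D. (-1) ^ (card K - card I) * \<Lambda> K)"
proof -
  define f where "f S = v (D - S)" for S
  have tail_as_subset_sum: "sum f (Pow T) = \<Lambda> (D - T)" if "T \<subseteq> D - I" for T
  proof -
    have "sum f (Pow T) = (\<Sum>K | D - T \<subseteq> K \<and> K \<subseteq> D. v K)"
      by (rule sum.reindex_bij_witness[of _ "\<lambda>K. D - K" "\<lambda>S. D - S"])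
        (use that in \<open>auto simp: f_def\<close>)
    also have "\<dots> = \<Lambda> (D - T)"
      by (rule tail[symmetric]) (use that \<open>I \<subseteq> D\<close> in auto)
    finally show ?thesis .
  qed
  have "v I = f (D - I)"
    using \<open>I \<subseteq> D\<close> by (simp add: f_def double_diff)
  also have "\<dots> = (\<Sum>T \<in> Pow (D - I). (-1) ^ (card (D - I) - card T) * sum f (Pow T))"
    by (rule inclusion_exclusion_mobius) (use \<open>finite D\<close> in auto)
  also have "\<dots> = (\<Sum>T \<in> Pow (D - I). (-1) ^ (card (D - I) - card T) * \<Lambda> (D - T))"
    by (simp add: tail_as_subset_sum)
  also have "\<dots> = (\<Sum>K | I \<subseteq> K \<and> K \<subseteq> D. (-1) ^ (card K - card I) * \<Lambda> K)"
  proof (rule sum.reindex_bij_witness[of _ "\<lambda>K. D - K" "\<lambda>T. D - T"])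
    fix T assume T: "T \<in> Pow (D - I)"
    then have "card (D - T) - card I = card (D - I) - card T"
      using \<open>finite D\<close> \<open>I \<subseteq> D\<close> by (simp add: card_Diff_subset finite_subset[of _ D] subset_iff)
    then show "(-1) ^ (card (D - T) - card I) * \<Lambda> (D - T)
        = (-1) ^ (card (D - I) - card T) * \<Lambda> (D - T)"
      by simp
  qed (use \<open>I \<subseteq> D\<close> in auto)
  finally show ?thesis .
qed

lemma finite_sign_patterns: "finite I \<Longrightarrow> finite (sign_patterns I)"
proof (rule finite_PiE)
  have "(UNIV :: side set) = {Lower, Upper}"
    using side.exhaust by auto
  then show "finite (UNIV :: side set)"
    by (metis finite.emptyI finite_insert)
qed

lemma signed_tail_iterated_sum:
  assumes "J \<noteq> {}"
  shows "signed_tail d w (J, \<tau>) =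
    (\<Sum>K | J \<subseteq> K \<and> K \<subseteq> {1..d}. \<Sum>\<rho> \<in> {\<rho> \<in> sign_patterns K. restrict \<rho> J = \<tau>}. w (K, \<rho>))"
proof -
  have index_set: "{(I, \<sigma>) \<in> generators d. J \<subseteq> I \<and> restrict \<sigma> J = \<tau>} =
      (SIGMA K : {K. J \<subseteq> K \<and> K \<subseteq> {1..d}}. {\<rho> \<in> sign_patterns K. restrict \<rho> J = \<tau>})"
    using assms by (auto simp: generators_def nonempty_subsets_def)
  have "finite {K. J \<subseteq> K \<and> K \<subseteq> {1..d}}"
    by (rule finite_subset[of _ "Pow {1..d}"]) auto
  moreover have "finite {\<rho> \<in> sign_patterns K. restrict \<rho> J = \<tau>}"
    if "K \<in> {K. J \<subseteq> K \<and> K \<subseteq> {1..d}}" for K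
    using that finite_subset[of K "{1..d}"] by (simp add: finite_sign_patterns)
  ultimately show ?thesis
    by (simp add: signed_tail_def index_set sum.Sigma)
qed

text \<open>
  The recursion subtracts from the tail at \<open>I\<close> the values at strict supersets of \<open>I\<close>, which by
  induction are the weights there; what is left is the term \<open>K = I\<close> of the tail.
\<close>

theorem backward_recovery_signed_tail:
  assumes "(I, \<sigma>) \<in> generators d"
  shows "backward_recovery d (signed_tail d w) (I, \<sigma>) = w (I, \<sigma>)"
  using assms
proof (induction "card ({1..d} - I)" arbitrary: I \<sigma> rule: less_induct)
  case less
  let ?inner = "\<lambda>K. \<Sum>\<rho> \<in> {\<rho> \<in> sign_patterns K. restrict \<rho> I = \<sigma>}. w (K, \<rho>)"
  have I: "I \<noteq> {}" "I \<subseteq> {1..d}" and \<sigma>: "\<sigma> \<in> sign_patterns I"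
    using less.prems by (auto simp: generators_def nonempty_subsets_def)
  have "backward_recovery d (signed_tail d w) (K, \<rho>) = w (K, \<rho>)"
    if "I \<subset> K" "K \<subseteq> {1..d}" "\<rho> \<in> sign_patterns K" for K \<rho>
  proof (rule less.hyps)
    show "card ({1..d} - K) < card ({1..d} - I)"
      by (rule psubset_card_mono) (use that in auto)
    show "(K, \<rho>) \<in> generators d"
      using that by (auto simp: generators_def nonempty_subsets_def)
  qed
  then have "backward_recovery d (signed_tail d w) (I, \<sigma>) =
      signed_tail d w (I, \<sigma>) - (\<Sum>K | I \<subset> K \<and> K \<subseteq> {1..d}. ?inner K)"
    by (subst backward_recovery.simps) (auto intro!: sum.cong)
  also have "signed_tail d w (I, \<sigma>) = ?inner I + (\<Sum>K | I \<subset> K \<and> K \<subseteq> {1..d}. ?inner K)"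
  proof -
    have "{K. I \<subseteq> K \<and> K \<subseteq> {1..d}} = insert I {K. I \<subset> K \<and> K \<subseteq> {1..d}}"
      using I by auto
    moreover have "finite {K. I \<subset> K \<and> K \<subseteq> {1..d}}"
      by (rule finite_subset[of _ "Pow {1..d}"]) auto
    ultimately show ?thesis
      using I by (simp add: signed_tail_iterated_sum)
  qed
  also have "?inner I = w (I, \<sigma>)"
  proof -
    have "{\<rho> \<in> sign_patterns I. restrict \<rho> I = \<sigma>} = {\<sigma>}"
      using \<sigma> by (auto simp: PiE_restrict)
    then show ?thesis by simp
  qed
  finally show ?case by simp
qed

lemma upper_supported_eq_0:
  assumes "upper_supported d w" and "(I, \<sigma>) \<in> generators d" and "\<sigma> \<noteq> all_upper I"
  shows "w (I, \<sigma>) = 0"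
proof -
  have "\<sigma> \<in> sign_patterns I"
    using assms(2) by (simp add: generators_def)
  then have "\<not> (\<forall>i\<in>I. \<sigma> i = Upper)"
    using assms(3) by (auto simp: all_upper_def PiE_def extensional_def fun_eq_iff split: if_splits)
  then show ?thesis
    using assms(1,2) by (auto simp: upper_supported_def)
qed

lemma all_upper_generator: "I \<in> nonempty_subsets d \<Longrightarrow> (I, all_upper I) \<in> generators d"
  by (simp add: generators_def all_upper_def)

text \<open>
  The all-\<open>Upper\<close> pattern on \<open>K\<close> extends the one on \<open>J\<close>, and every other extension to \<open>K\<close>
  has weight zero.
\<close>

lemma upper_part_signed_tail:
  assumes "upper_supported d w" and J: "J \<in> nonempty_subsets d"
  shows "upper_part (signed_tail d w) J = (\<Sum>K | J \<subseteq> K \<and> K \<subseteq> {1..d}. upper_part w K)"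
proof -
  have "(\<Sum>\<rho> \<in> {\<rho> \<in> sign_patterns K. restrict \<rho> J = all_upper J}. w (K, \<rho>)) = upper_part w K"
    if K: "J \<subseteq> K" "K \<subseteq> {1..d}" for K
  proof -
    have K': "K \<in> nonempty_subsets d"
      using K J by (auto simp: nonempty_subsets_def)
    have "(\<Sum>\<rho> \<in> {all_upper K}. w (K, \<rho>)) =
        (\<Sum>\<rho> \<in> {\<rho> \<in> sign_patterns K. restrict \<rho> J = all_upper J}. w (K, \<rho>))"
    proof (rule sum.mono_neutral_left)
      show "finite {\<rho> \<in> sign_patterns K. restrict \<rho> J = all_upper J}"
        using K finite_subset[of K "{1..d}"] by (simp add: finite_sign_patterns)
      show "{all_upper K} \<subseteq> {\<rho> \<in> sign_patterns K. restrict \<rho> J = all_upper J}"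
        using K by (auto simp: all_upper_def Int_absorb1 Int_absorb2)
      show "\<forall>\<rho> \<in> {\<rho> \<in> sign_patterns K. restrict \<rho> J = all_upper J} - {all_upper K}.
          w (K, \<rho>) = 0"
        using K' by (auto intro!: upper_supported_eq_0[OF assms(1)] simp: generators_def)
    qed
    then show ?thesis by (simp add: upper_part_def)
  qed
  moreover have "J \<noteq> {}"
    using J by (simp add: nonempty_subsets_def)
  ultimately show ?thesis
    by (simp add: upper_part_def[of "signed_tail d w"] signed_tail_iterated_sum)
qed

lemma sum_zeta:
  assumes "J \<in> nonempty_subsets d"
  shows "(\<Sum>I \<in> nonempty_subsets d. zeta J I * v I) = (\<Sum>I | J \<subseteq> I \<and> I \<subseteq> {1..d}. v I)"
proof (rule sum.mono_neutral_cong_right)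
  show "finite (nonempty_subsets d)"
    by (rule finite_subset[of _ "Pow {1..d}"]) (auto simp: nonempty_subsets_def)
qed (use assms in \<open>auto simp: nonempty_subsets_def zeta_def\<close>)

theorem proposition3:
  fixes d :: nat
    and w :: "nat set \<times> pattern \<Rightarrow> real"
  assumes "d \<ge> 1"
    and "upper_supported d w"
  shows
    "(\<forall>J \<in> nonempty_subsets d.
        upper_part (signed_tail d w) J = (\<Sum>I | J \<subseteq> I \<and> I \<subseteq> {1..d}. upper_part w I) \<and>
        upper_part (signed_tail d w) J = (\<Sum>I \<in> nonempty_subsets d. zeta J I * upper_part w I)) \<and>
     (\<forall>(I, \<sigma>) \<in> generators d. \<sigma> \<noteq> all_upper I \<longrightarrow>
        backward_recovery d (signed_tail d w) (I, \<sigma>) = 0) \<and>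
     (\<forall>I \<in> nonempty_subsets d.
        upper_part (backward_recovery d (signed_tail d w)) I =
          (\<Sum>K | I \<subseteq> K \<and> K \<subseteq> {1..d}.
             (-1) ^ (card K - card I) * upper_part (signed_tail d w) K) \<and>
        upper_part w I =
          (\<Sum>K | I \<subseteq> K \<and> K \<subseteq> {1..d}.
             (-1) ^ (card K - card I) * upper_part (signed_tail d w) K))"
proof -
  have moebius: "upper_part w I =
      (\<Sum>K | I \<subseteq> K \<and> K \<subseteq> {1..d}. (-1) ^ (card K - card I) * upper_part (signed_tail d w) K)"
    if I: "I \<in> nonempty_subsets d" for I
  proof (rule superset_moebius_inversion)
    fix J assume "I \<subseteq> J" "J \<subseteq> {1..d}"
    then have "J \<in> nonempty_subsets d"
      using I by (auto simp: nonempty_subsets_def)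
    then show "upper_part (signed_tail d w) J = (\<Sum>K | J \<subseteq> K \<and> K \<subseteq> {1..d}. upper_part w K)"
      by (rule upper_part_signed_tail[OF assms(2)])
  qed (use I in \<open>auto simp: nonempty_subsets_def\<close>)
  have recovery: "upper_part (backward_recovery d (signed_tail d w)) I = upper_part w I"
    if "I \<in> nonempty_subsets d" for I
    using that by (simp add: upper_part_def backward_recovery_signed_tail all_upper_generator)
  have vanishing: "backward_recovery d (signed_tail d w) (I, \<sigma>) = 0"
    if "(I, \<sigma>) \<in> generators d" "\<sigma> \<noteq> all_upper I" for I \<sigma>
    using that by (simp add: backward_recovery_signed_tail upper_supported_eq_0[OF assms(2)])
  show ?thesis
  proof (intro conjI ballI)
    fix J assume J: "J \<in> nonempty_subsets d"
    show "upper_part (signed_tail d w) J = (\<Sum>I | J \<subseteq> I \<and> I \<subseteq> {1..d}. upper_part w I)"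
      by (rule upper_part_signed_tail[OF assms(2) J])
    then show "upper_part (signed_tail d w) J =
        (\<Sum>I \<in> nonempty_subsets d. zeta J I * upper_part w I)"
      by (simp add: sum_zeta[OF J])
  next
    fix I assume I: "I \<in> nonempty_subsets d"
    show "upper_part w I = (\<Sum>K | I \<subseteq> K \<and> K \<subseteq> {1..d}.
        (-1) ^ (card K - card I) * upper_part (signed_tail d w) K)"
      by (rule moebius[OF I])
    then show "upper_part (backward_recovery d (signed_tail d w)) I = (\<Sum>K | I \<subseteq> K \<and> K \<subseteq> {1..d}.
        (-1) ^ (card K - card I) * upper_part (signed_tail d w) K)"
      by (simp only: recovery[OF I])
  qed (use vanishing in auto)
qed

end
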